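(* Let $L=\|K\|$, let $\tau,\sigma>0$ satisfy $\tau\sigma L^2<1$, and let $(x^n,y^n)_{n\ge0}$ be generated from $(x^0,y^0)\in\mathcal X\times\mathcal Y$, with $x^{-1}=x^0$, by $$y^{n+1}\approx_2^{\delta_{n+1}}\mathrm{prox}_{\sigma h^*}\big(y^n+\sigma K(2x^n-x^{n-1})\big),\qquad x^{n+1}\approx_2^{\varepsilon_{n+1}}\mathrm{prox}_{\tau g}\big(x^n-\tau K^*y^{n+1}\big),\qquad n\ge0,$$ where $\varepsilon_n,\delta_n\ge0$ $(n\ge1)$. Put $X^N:=\frac1N\sum_{n=1}^Nx^n$ and $Y^N:=\frac1N\sum_{n=1}^Ny^n$. Then for every $N\ge1$ and every $(x,y)\in\mathcal X\times\mathcal Y$, $$\mathcal L(X^N,y)-\mathcal L(x,Y^N)\le\frac1N\Big(\frac1{2\tau}\|x-x^0\|^2+\frac1{2\sigma}\|y-y^0\|^2+\sum_{n=1}^N(\varepsilon_n+\delta_n)\Big).$$ Furthermore, if for some $\alpha>0$ one has $\varepsilon_n=O(n^{-\alpha})$ and $\delta_n=O(n^{-\alpha})$, then for every $(x,y)\in\mathcal X\times\mathcal Y$ there is a constant $C$ such that for all $N\ge2$ $$\mathcal L(X^N,y)-\mathcal L(x,Y^N)\le\begin{cases}C\,N^{-1}&\text{if }\alpha>1,\\C\,\ln(N)/N&\text{if }\alpha=1,\\C\,N^{-\alpha}&\text{if }\alpha\in(0,1).\end{cases}$$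
   Context: $\mathcal X,\mathcal Y$ are real Hilbert spaces and $\bar{\mathbb R}=\mathbb R\cup\{+\infty\}$. $K:\mathcal X\to\mathcal Y$ is a bounded linear operator; $g:\mathcal X\to\bar{\mathbb R}$ and $h:\mathcal Y\to\bar{\mathbb R}$ are proper, convex, lower semicontinuous; $h^*$ is the convex conjugate of $h$. Put $$\mathcal L(x,y)=\langle y,Kx\rangle+g(x)-h^*(y).$$ A saddle point is a pair $(x^\star,y^\star)$ with $\mathcal L(x^\star,y)\le\mathcal L(x^\star,y^\star)\le\mathcal L(x,y^\star)$ for all $(x,y)\in\mathcal X\times\mathcal Y$; at least one is assumed to exist. Type-2 inexact proximal points. For a proper, convex, lower semicontinuous $\varphi:\mathcal H\to\bar{\mathbb R}$ on a Hilbert space $\mathcal H$, $\lambda>0$, $v\in\mathcal H$ and $\varepsilon\ge0$, let $\mathrm{prox}_{\lambda\varphi}(v)=\arg\min_{u}\{\frac1{2\lambda}\|u-v\|^2+\varphi(u)\}$ and $\partial_\varepsilon\varphi(z)=\{p:\varphi(u)\ge\varphi(z)+\langle p,u-z\rangle-\varepsilon\ \forall u\}$. Then $z\approx_2^{\varepsilon}\mathrm{prox}_{\lambda\varphi}(v)$ means $(v-z)/\lambda\in\partial_\varepsilon\varphi(z)$. *)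

theory Defs
  imports "HOL-Analysis.Analysis" "HOL-Library.Landau_Symbols"
begin

text \<open>
  Functions with values in the reals extended by \<open>+\<infinity>\<close> are \<^typ>\<open>ereal\<close>-valued functions; the value
  \<open>-\<infinity>\<close> is excluded by properness.
\<close>

definition proper_fun :: "('a \<Rightarrow> ereal) \<Rightarrow> bool" where
  "proper_fun f \<longleftrightarrow> (\<forall>x. f x \<noteq> -\<infinity>) \<and> (\<exists>x. f x \<noteq> \<infinity>)"

definition convex_fun :: "('a::real_vector \<Rightarrow> ereal) \<Rightarrow> bool" where
  "convex_fun f \<longleftrightarrow>
    (\<forall>x y. \<forall>u\<ge>0. \<forall>v\<ge>0. u + v = 1 \<longrightarrow>
      f (u *\<^sub>R x + v *\<^sub>R y) \<le> ereal u * f x + ereal v * f y)"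

definition lsc_fun :: "('a::topological_space \<Rightarrow> ereal) \<Rightarrow> bool" where
  "lsc_fun f \<longleftrightarrow> (\<forall>x. f x \<le> Liminf (nhds x) f)"

definition conjugate :: "('a::real_inner \<Rightarrow> ereal) \<Rightarrow> 'a \<Rightarrow> ereal" where
  "conjugate f p = (SUP u. ereal (p \<bullet> u) - f u)"

definition eps_subdifferential :: "real \<Rightarrow> ('a::real_inner \<Rightarrow> ereal) \<Rightarrow> 'a \<Rightarrow> 'a set" where
  "eps_subdifferential \<epsilon> f z = {p. \<forall>u. f u \<ge> f z + ereal (p \<bullet> (u - z)) - ereal \<epsilon>}"

text \<open>
  \<open>inexact_prox2 \<epsilon> \<mu> f v z\<close> says that \<open>z\<close> is a type-2 approximation, with accuracy \<open>\<epsilon>\<close>, of the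
  proximal point of \<open>\<mu> f\<close> at \<open>v\<close>, i.e. of the minimiser of \<open>u \<mapsto> \<parallel>u - v\<parallel>\<^sup>2 / (2 \<mu>) + f u\<close>.
\<close>

definition inexact_prox2 :: "real \<Rightarrow> real \<Rightarrow> ('a::real_inner \<Rightarrow> ereal) \<Rightarrow> 'a \<Rightarrow> 'a \<Rightarrow> bool" where
  "inexact_prox2 \<epsilon> \<mu> f v z \<longleftrightarrow> (1 / \<mu>) *\<^sub>R (v - z) \<in> eps_subdifferential \<epsilon> f z"

text \<open>
  In \<^typ>\<open>ereal\<close>, \<open>\<infinity> - \<infinity> = \<infinity>\<close>, so the Lagrangian is \<open>\<infinity>\<close> whenever \<open>g x = \<infinity>\<close>. For proper \<open>g\<close> and
  proper \<open>conjugate h\<close> this convention does not affect which points are saddle points: any saddle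
  point \<open>(x, y)\<close> has \<open>g x\<close> and \<open>conjugate h y\<close> finite.
\<close>

definition lagrangian ::
  "('a \<Rightarrow> 'b::real_inner) \<Rightarrow> ('a \<Rightarrow> ereal) \<Rightarrow> ('b \<Rightarrow> ereal) \<Rightarrow> 'a \<Rightarrow> 'b \<Rightarrow> ereal" where
  "lagrangian K g h x y = ereal (y \<bullet> K x) + g x - conjugate h y"

definition saddle_point :: "('a \<Rightarrow> 'b \<Rightarrow> ereal) \<Rightarrow> 'a \<Rightarrow> 'b \<Rightarrow> bool" where
  "saddle_point \<L> xs ys \<longleftrightarrow> (\<forall>x y. \<L> xs y \<le> \<L> xs ys \<and> \<L> xs ys \<le> \<L> x ys)"

definition ergodic_mean :: "(nat \<Rightarrow> 'a::real_vector) \<Rightarrow> nat \<Rightarrow> 'a" where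
  "ergodic_mean x N = (1 / real N) *\<^sub>R (\<Sum>n=1..N. x n)"

end

theory Submission
  imports Defs
begin

text \<open>
  Adding the two \<open>\<epsilon>\<close>-subgradient inequalities bounds the gap at step \<open>n + 1\<close> by telescoping squared
  distances, minus the squared increments of both sequences, plus the coupling term
  \<open>\<langle>v - y\<^sub>n\<^sub>+\<^sub>1, K (x\<^sub>n\<^sub>+\<^sub>1 - x\<^sub>n) - K (x\<^sub>n - x\<^sub>n\<^sub>-\<^sub>1)\<rangle>\<close>. The extrapolation makes the coupling telescope up to
  \<open>\<langle>y\<^sub>n\<^sub>+\<^sub>1 - y\<^sub>n, K (x\<^sub>n - x\<^sub>n\<^sub>-\<^sub>1)\<rangle>\<close>, which the squared increments absorb because \<open>\<tau> \<sigma> L\<^sup>2 \<le> 1\<close>. Jensen's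
  inequality passes to the ergodic means, and the rates come from the partial sums of \<open>n\<^sup>-\<^sup>\<alpha>\<close>.

  Points where \<open>g u\<close> or \<open>conjugate h v\<close> is infinite are harmless only if \<open>conjugate h\<close> is proper:
  were it constantly \<open>\<infinity>\<close>, the gap would be \<open>-\<infinity> - (-\<infinity>) = \<infinity>\<close>. Properness amounts to an affine
  minorant of \<open>h\<close>, obtained by projecting a point below the epigraph onto it.
\<close>

section \<open>Projection onto closed convex sets, Riesz representation and adjoints\<close>

lemma dist_sq_midpoint:
  fixes a u v :: "'a::real_inner"
  shows "(dist u v)\<^sup>2 = 2 * (dist a u)\<^sup>2 + 2 * (dist a v)\<^sup>2
    - 4 * (dist a ((1/2) *\<^sub>R u + (1/2) *\<^sub>R v))\<^sup>2"
  unfolding dist_norm power2_norm_eq_inner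
  by (simp add: inner_simps inner_commute algebra_simps)

text \<open>Completeness replaces compactness: near-minimisers of the distance form nested closed
  sets, and the parallelogram law at the midpoint of two of them, which stays in \<open>S\<close>,
  makes the diameters shrink to zero.\<close>

lemma closest_point_exists_complete:
  fixes S :: "'a::{real_inner,complete_space} set"
  assumes S: "convex S" "closed S" "S \<noteq> {}"
  obtains w where "w \<in> S" "\<And>z. z \<in> S \<Longrightarrow> dist a w \<le> dist a z"
proof -
  define d where "d = infdist a S"
  have d_le: "d \<le> dist a z" if "z \<in> S" for z
    using that by (simp add: d_def infdist_le)
  have "0 \<le> d"
    by (simp add: d_def infdist_nonneg)
  \<comment> \<open>The slack is added to the squared distance, so the parallelogram law gives
    squared diameter at most \<open>4 / real (Suc n)\<close>.\<close>
  define T where "T n = S \<inter> cball a (sqrt (d\<^sup>2 + 1 / real (Suc n)))" for n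
  have T_sq: "(dist a z)\<^sup>2 \<le> d\<^sup>2 + 1 / real (Suc n)" if "z \<in> T n" for z n
  proof -
    have "dist a z \<le> sqrt (d\<^sup>2 + 1 / real (Suc n))"
      using that by (simp add: T_def)
    then have "(dist a z)\<^sup>2 \<le> (sqrt (d\<^sup>2 + 1 / real (Suc n)))\<^sup>2"
      by (intro power_mono) auto
    then show ?thesis
      by (simp add: add_nonneg_nonneg)
  qed
  have "\<exists>w. \<forall>n. w \<in> T n"
  proof (rule decreasing_closed_nest[of T])
    show "closed (T n)" for n
      using S by (auto simp: T_def)
    show "T n \<noteq> {}" for n
    proof -
      have "d < sqrt (d\<^sup>2 + 1 / real (Suc n))"
        by (rule real_less_rsqrt) simp
      then obtain z where "z \<in> S" "dist a z < sqrt (d\<^sup>2 + 1 / real (Suc n))"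
        unfolding d_def infdist_notempty[OF S(3)]
        by (subst (asm) cINF_less_iff) (use S in auto)
      then show ?thesis
        by (auto simp: T_def intro!: exI[of _ z])
    qed
    show "T n \<subseteq> T m" if "m \<le> n" for m n
    proof -
      have "sqrt (d\<^sup>2 + 1 / real (Suc n)) \<le> sqrt (d\<^sup>2 + 1 / real (Suc m))"
        using that by (intro real_sqrt_le_mono add_left_mono divide_left_mono) auto
      then show ?thesis
        unfolding T_def by (intro Int_mono order_refl subset_cball)
    qed
    show "\<exists>n. \<forall>u\<in>T n. \<forall>v\<in>T n. dist u v < e" if "e > 0" for e
    proof -
      obtain n where n: "4 / e\<^sup>2 < real n"
        using reals_Archimedean2 by blast
      have "dist u v < e" if uv: "u \<in> T n" "v \<in> T n" for u v
      proof -
        have "(1/2) *\<^sub>R u + (1/2) *\<^sub>R v \<in> S"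
          using uv S(1) by (intro convexD) (auto simp: T_def)
        then have "d\<^sup>2 \<le> (dist a ((1/2) *\<^sub>R u + (1/2) *\<^sub>R v))\<^sup>2"
          using \<open>0 \<le> d\<close> d_le by (intro power_mono) auto
        then have "(dist u v)\<^sup>2 \<le> 4 / real (Suc n)"
          using T_sq[OF uv(1)] T_sq[OF uv(2)] dist_sq_midpoint[of u v a] by linarith
        also have "\<dots> < e\<^sup>2"
          using n \<open>e > 0\<close> by (simp add: field_simps add_strict_increasing)
        finally show ?thesis
          using \<open>e > 0\<close> by (simp add: power2_less_imp_less)
      qed
      then show ?thesis by blast
    qed
  qed blast
  then obtain w where w: "\<And>n. w \<in> T n" by blast
  have "dist a w \<le> dist a z" if "z \<in> S" for z
  proof -
    have "(dist a w)\<^sup>2 \<le> d\<^sup>2"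
    proof (rule field_le_epsilon)
      fix e :: real assume "e > 0"
      then obtain n where "1 / real (Suc n) < e"
        using nat_approx_posE by blast
      then show "(dist a w)\<^sup>2 \<le> d\<^sup>2 + e"
        using T_sq[OF w, of n] by linarith
    qed
    then show ?thesis
      using \<open>0 \<le> d\<close> d_le[OF that] power2_le_imp_le by force
  qed
  then show thesis
    using that w[of 0] by (auto simp: T_def)
qed

lemma projection_complete:
  fixes S :: "'a::{real_inner,complete_space} set"
  assumes "convex S" "closed S" "S \<noteq> {}"
  obtains w where "w \<in> S" "\<And>z. z \<in> S \<Longrightarrow> (a - w) \<bullet> (z - w) \<le> 0"
  by (metis closest_point_exists_complete[OF assms] any_closest_point_dot[OF assms(1,2)])

lemma riesz_representation_complete:
  fixes f :: "'a::{real_inner,complete_space} \<Rightarrow> real"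
  assumes "bounded_linear f"
  obtains w where "\<And>x. f x = x \<bullet> w"
proof (cases "\<forall>x. f x = 0")
  case True
  then show ?thesis using that[of 0] by simp
next
  case False
  interpret bounded_linear f by fact
  from False obtain x0 where "f x0 \<noteq> 0" by blast
  \<comment> \<open>the element of minimal norm in this hyperplane is orthogonal to the kernel of \<open>f\<close>\<close>
  define S where "S = {x. f x = 1}"
  have "convex S"
    by (auto simp: convex_def S_def add scale)
  moreover have "closed S"
    unfolding S_def by (intro closed_Collect_eq continuous_intros linear_continuous_on assms)
  moreover have "(1 / f x0) *\<^sub>R x0 \<in> S"
    using \<open>f x0 \<noteq> 0\<close> by (simp add: S_def scale)
  ultimately obtain w where w: "w \<in> S" "\<And>z. z \<in> S \<Longrightarrow> (0 - w) \<bullet> (z - w) \<le> 0"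
    using projection_complete[of S 0] by blast
  \<comment> \<open>Both \<open>w + k\<close> and \<open>w - k\<close> stay in the hyperplane, so
    the variational inequality bounds \<open>w \<bullet> k\<close> from both sides.\<close>
  have ker: "w \<bullet> k = 0" if "f k = 0" for k
    using w(2)[of "w + k"] w(2)[of "w - k"] w(1) that
    by (simp add: S_def add diff inner_simps)
  have "w \<noteq> 0"
    using w(1) zero by (auto simp: S_def)
  show ?thesis
  proof (rule that)
    fix x
    have "w \<bullet> (x - f x *\<^sub>R w) = 0"
      using w(1) by (intro ker) (simp add: S_def diff scale)
    then show "f x = x \<bullet> ((1 / (w \<bullet> w)) *\<^sub>R w)"
      using \<open>w \<noteq> 0\<close> by (simp add: inner_simps inner_commute)
  qed
qed

text \<open>\<open>adjoint\<close> is a choice among the maps with this property, so the identity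
  holds as soon as one such map exists; Riesz representation supplies it pointwise in
  \<open>y\<close>.\<close>

lemma inner_adjoint:
  fixes K :: "'a::{real_inner,complete_space} \<Rightarrow> 'b::real_inner"
  assumes "bounded_linear K"
  shows "K x \<bullet> y = x \<bullet> adjoint K y"
proof -
  have "\<exists>w. \<forall>x. K x \<bullet> y = x \<bullet> w" for y
    using riesz_representation_complete[of "\<lambda>x. K x \<bullet> y"]
      bounded_linear_compose[OF bounded_linear_inner_left assms] by metis
  then have "\<exists>K'. \<forall>x y. K x \<bullet> y = x \<bullet> K' y"
    by metis
  then show ?thesis
    unfolding adjoint_def by (rule someI2_ex) blast
qed

section \<open>Epigraphs and properness of the conjugate\<close>

lemma convex_epigraph_ereal:
  assumes "convex_fun f"
  shows "convex {(z, r). f z \<le> ereal r}"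
proof (rule convexI, clarsimp)
  fix x y r s and u v :: real
  assume "f x \<le> ereal r" "f y \<le> ereal s" "0 \<le> u" "0 \<le> v" "u + v = 1"
  then have "ereal u * f x + ereal v * f y \<le> ereal u * ereal r + ereal v * ereal s"
    by (intro add_mono ereal_mult_left_mono) auto
  then show "f (u *\<^sub>R x + v *\<^sub>R y) \<le> ereal (u * r + v * s)"
    using assms \<open>0 \<le> u\<close> \<open>0 \<le> v\<close> \<open>u + v = 1\<close>
    unfolding convex_fun_def by (metis order_trans plus_ereal.simps(1) times_ereal.simps(1))
qed

text \<open>If a limit point fell outside, some \<open>c\<close> would lie strictly between
  \<open>r\<close> and \<open>f z\<close>. Semicontinuity keeps the function values above
  \<open>c\<close> eventually, while the heights drop below \<open>c\<close>.\<close>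

lemma closed_epigraph_lsc:
  fixes f :: "'a::first_countable_topology \<Rightarrow> ereal"
  assumes "lsc_fun f"
  shows "closed {(z, r). f z \<le> ereal r}"
  unfolding closed_sequential_limits
proof (clarify, rule ccontr)
  fix p :: "nat \<Rightarrow> 'a \<times> real" and z r
  assume p: "\<forall>n. p n \<in> {(z, r). f z \<le> ereal r}" "p \<longlonglongrightarrow> (z, r)" and "\<not> f z \<le> ereal r"
  then have "ereal r < f z" by simp
  then obtain c where c: "ereal r < c" "c < f z"
    using dense by blast
  have "f z \<le> Liminf (nhds z) f"
    using assms by (simp add: lsc_fun_def)
  then have "eventually (\<lambda>u. c < f u) (nhds z)"
    using c(2) by (simp add: le_Liminf_iff)
  then have "eventually (\<lambda>n. c < f (fst (p n))) sequentially"
    using tendsto_fst[OF p(2)] by (auto simp: filterlim_iff)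
  moreover have "eventually (\<lambda>n. ereal (snd (p n)) < c) sequentially"
    using order_tendstoD(2)[OF tendsto_ereal[OF tendsto_snd[OF p(2)]], of c] c(1) by simp
  ultimately have "eventually (\<lambda>n. False) sequentially"
  proof eventually_elim
    case (elim n)
    with p(1) show False
      by (metis (no_types, lifting) case_prodE fst_conv snd_conv mem_Collect_eq
          order.strict_trans not_less)
  qed
  then show False by simp
qed

lemma affine_minorant:
  fixes h :: "'a::{real_inner,complete_space} \<Rightarrow> ereal"
  assumes h: "proper_fun h" "convex_fun h" "lsc_fun h"
  obtains p c where "\<And>u. ereal (p \<bullet> u - c) \<le> h u"
proof -
  obtain u0 where "h u0 \<noteq> \<infinity>" "h u0 \<noteq> -\<infinity>"
    using h(1) by (auto simp: proper_fun_def)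
  then obtain r0 where r0: "h u0 = ereal r0"
    by (cases "h u0") auto
  let ?E = "{(z, r). h z \<le> ereal r}"
  have "(u0, r0) \<in> ?E" using r0 by simp
  then have "?E \<noteq> {}" by blast
  then obtain ws where "ws \<in> ?E"
    and proj: "\<And>z. z \<in> ?E \<Longrightarrow> ((u0, r0 - 1) - ws) \<bullet> (z - ws) \<le> 0"
    using projection_complete[OF convex_epigraph_ereal[OF h(2)] closed_epigraph_lsc[OF h(3)], of "(u0, r0 - 1)"]
    by blast
  then obtain w s where ws: "ws = (w, s)" "h w \<le> ereal s"
    by auto
  \<comment> \<open>The vertical gap between the projection and the point below the epigraph; once
    positive, dividing by it turns the separating hyperplane into the graph of an affine
    function.\<close>
  define q where "q = s - (r0 - 1)"
  have proj': "(u0 - w) \<bullet> (z - w) \<le> q * (r - s)" if "h z \<le> ereal r" for z r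
    using proj[of "(z, r)"] that by (simp add: ws q_def algebra_simps)
  \<comment> \<open>The epigraph is closed under raising the height, so the projection inequality
    can be tested one unit above the projection.\<close>
  have "q \<ge> 0"
    using proj'[of w "s + 1"] ws by (simp add: order_trans[OF ws(2)])
  \<comment> \<open>A vertical hyperplane is excluded by testing with \<open>(u0, r0)\<close>: it
    would force \<open>w = u0\<close> at height \<open>r0 - 1\<close>, below the value of
    \<open>h\<close>.\<close>
  have "q \<noteq> 0"
  proof
    assume "q = 0"
    then have "(u0 - w) \<bullet> (u0 - w) \<le> 0"
      using proj'[of u0 r0] r0 by simp
    then have "u0 = w"
      by (metis inner_gt_zero_iff not_less eq_iff_diff_eq_0)
    then show False
      using ws(2) r0 \<open>q = 0\<close> by (simp add: q_def)
  qed
  with \<open>q \<ge> 0\<close> have "q > 0" by simp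
  show thesis
  proof (rule that)
    fix u
    show "ereal (((1 / q) *\<^sub>R (u0 - w)) \<bullet> u - (((1 / q) *\<^sub>R (u0 - w)) \<bullet> w - s)) \<le> h u"
    proof (cases "h u")
      case (real r)
      then have "(u0 - w) \<bullet> (u - w) / q \<le> r - s"
        using proj'[of u r] \<open>q > 0\<close> by (simp add: pos_divide_le_eq mult.commute)
      then show ?thesis
        using real by (simp add: inner_diff_right diff_divide_distrib)
    next
      case MInf
      then show ?thesis using h(1) by (simp add: proper_fun_def)
    qed simp
  qed
qed

lemma conjugate_not_MInf:
  assumes "proper_fun h"
  shows "conjugate h p \<noteq> -\<infinity>"
proof -
  obtain u r where "h u = ereal r"
    using assms by (metis proper_fun_def uminus_ereal.simps(3) ereal_cases)
  then have "ereal (p \<bullet> u - r) \<le> conjugate h p"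
    unfolding conjugate_def by (intro SUP_upper2[of u]) auto
  then show ?thesis by auto
qed

text \<open>At the slope of an affine minorant of \<open>h\<close>, the conjugate is at most the
  constant of that minorant.\<close>

lemma proper_conjugate:
  fixes h :: "'a::{real_inner,complete_space} \<Rightarrow> ereal"
  assumes h: "proper_fun h" "convex_fun h" "lsc_fun h"
  shows "proper_fun (conjugate h)"
proof -
  obtain p c where pc: "\<And>u. ereal (p \<bullet> u - c) \<le> h u"
    using affine_minorant[OF h] by blast
  have "conjugate h p \<le> ereal c"
    unfolding conjugate_def
  proof (rule SUP_least)
    fix u
    show "ereal (p \<bullet> u) - h u \<le> ereal c"
      using pc[of u] by (cases "h u") auto
  qed
  then show ?thesis
    using conjugate_not_MInf[OF h(1)] by (auto simp: proper_fun_def intro!: exI[of _ p])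
qed

text \<open>A supremum of affine functions has an intersection of half-spaces as epigraph. Points
  with \<open>h u = \<infinity>\<close> contribute the whole space.\<close>

lemma convex_epigraph_conjugate:
  assumes "proper_fun h"
  shows "convex {(p, r). conjugate h p \<le> ereal r}"
proof -
  have "{(p, r). conjugate h p \<le> ereal r} = (\<Inter>u. {(p, r). ereal (p \<bullet> u) - h u \<le> ereal r})"
    by (auto simp: conjugate_def SUP_le_iff)
  also have "convex \<dots>"
  proof (rule convex_INT)
    fix u
    show "convex {(p, r). ereal (p \<bullet> u) - h u \<le> ereal r}"
    proof (cases "h u")
      case (real c)
      then have "{(p, r). ereal (p \<bullet> u) - h u \<le> ereal r} = {z. (u, -1) \<bullet> z \<le> c}"
        by (auto simp: inner_commute)
      then show ?thesis by (simp add: convex_halfspace_le)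
    qed (use assms in \<open>auto simp: proper_fun_def case_prod_unfold\<close>)
  qed
  finally show ?thesis .
qed

section \<open>Ergodic means and finiteness at the iterates\<close>

text \<open>Averaging the points \<open>(z n, r n)\<close> inside the epigraph keeps all sums real.
  Indices start at 1 because the initial point need not have a finite function value.\<close>

lemma jensen_ergodic_mean:
  assumes conv: "convex {(z, r). f z \<le> ereal r}" and "N \<ge> 1"
    and le: "\<And>n. n \<ge> 1 \<Longrightarrow> f (z n) \<le> ereal (r n)"
  shows "f (ergodic_mean z N) \<le> ereal (1 / real N * (\<Sum>n=1..N. r n))"
proof -
  have "(\<Sum>n\<in>{1..N}. (1 / real N) *\<^sub>R (z n, r n)) \<in> {(z, r). f z \<le> ereal r}"
    using \<open>N \<ge> 1\<close> le by (intro convex_sum[OF _ conv]) auto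
  moreover have "(\<Sum>n\<in>{1..N}. (1 / real N) *\<^sub>R (z n, r n))
      = (ergodic_mean z N, 1 / real N * (\<Sum>n=1..N. r n))"
    by (simp add: prod_eq_iff fst_sum snd_sum ergodic_mean_def scaleR_sum_right sum_distrib_left)
  ultimately show ?thesis by simp
qed

text \<open>An infinite value at \<open>z\<close> would propagate through the subgradient inequality
  to every \<open>u\<close>, against properness. Hence every inexact proximal point has a finite
  value.\<close>

lemma eps_subdifferential_finite:
  assumes "proper_fun f" "p \<in> eps_subdifferential \<epsilon> f z"
  obtains r where "f z = ereal r"
proof (cases "f z")
  case PInf
  have "f u \<ge> f z + ereal (p \<bullet> (u - z)) - ereal \<epsilon>" for u
    using assms(2) by (simp add: eps_subdifferential_def)
  with PInf have "f u = \<infinity>" for u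
    by simp
  then show ?thesis
    using assms(1) by (auto simp: proper_fun_def)
qed (use assms in \<open>auto simp: proper_fun_def\<close>)

lemma bounded_linear_ergodic_mean:
  assumes "N \<ge> 1" "bounded_linear f"
  shows "f (ergodic_mean z N) = 1 / real N * (\<Sum>n=1..N. f (z n))"
proof -
  interpret bounded_linear f by fact
  show ?thesis by (simp add: ergodic_mean_def scale sum)
qed

section \<open>The real-valued gap estimate\<close>

text \<open>Cauchy-Schwarz and Young's inequality with weight \<open>\<sigma>\<close>; the step-size
  condition then replaces \<open>\<sigma> * (onorm K)\<^sup>2\<close> by at most
  \<open>1 / \<tau>\<close>.\<close>

lemma coupling_bound:
  fixes K :: "'a::real_inner \<Rightarrow> 'b::real_inner"
  assumes K: "bounded_linear K"
    and steps: "\<tau> > 0" "\<sigma> > 0" "\<tau> * \<sigma> * (onorm K)\<^sup>2 \<le> 1"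
  shows "f \<bullet> K d \<le> 1 / (2 * \<sigma>) * (norm f)\<^sup>2 + 1 / (2 * \<tau>) * (norm d)\<^sup>2"
proof -
  let ?L = "onorm K"
  have "f \<bullet> K d \<le> norm f * norm (K d)"
    by (rule norm_cauchy_schwarz)
  also have "\<dots> \<le> norm f * (?L * norm d)"
    by (intro mult_left_mono onorm K) auto
  also have "\<dots> \<le> 1 / (2 * \<sigma>) * (norm f)\<^sup>2 + \<sigma> * ?L\<^sup>2 / 2 * (norm d)\<^sup>2"
  proof -
    have "0 \<le> 1 / (2 * \<sigma>) * (norm f - \<sigma> * ?L * norm d)\<^sup>2"
      using steps by simp
    also have "\<dots> = 1 / (2 * \<sigma>) * (norm f)\<^sup>2 + \<sigma> * ?L\<^sup>2 / 2 * (norm d)\<^sup>2 - norm f * (?L * norm d)"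
      using steps by (simp add: power2_eq_square field_simps)
    finally show ?thesis by simp
  qed
  also have "\<sigma> * ?L\<^sup>2 / 2 * (norm d)\<^sup>2 \<le> 1 / (2 * \<tau>) * (norm d)\<^sup>2"
    using steps by (intro mult_right_mono) (auto simp: field_simps)
  finally show ?thesis by simp
qed

text \<open>With \<open>a\<close> the old iterate, \<open>b\<close> the new one and \<open>u\<close>
  the comparison point, this turns the proximal term into a telescoping difference plus a squared
  increment.\<close>

lemma three_point_identity:
  fixes a b u :: "'a::real_inner"
  shows "1 / \<tau> * ((a - b) \<bullet> (u - b))
    = 1 / (2 * \<tau>) * (norm (u - b))\<^sup>2 + 1 / (2 * \<tau>) * (norm (b - a))\<^sup>2 - 1 / (2 * \<tau>) * (norm (u - a))\<^sup>2"
proof -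
  have "(a - b) \<bullet> (u - b) = ((norm (u - b))\<^sup>2 + (norm (b - a))\<^sup>2 - (norm (u - a))\<^sup>2) / 2"
    unfolding power2_norm_eq_inner by (simp add: inner_simps inner_commute algebra_simps)
  then show ?thesis
    by (simp only:) (simp add: add_divide_distrib diff_divide_distrib mult.commute)
qed

text \<open>The numbers \<open>G\<close>, \<open>H\<close>, \<open>gu\<close>, \<open>hv\<close>
  stand for finite function values, which keeps extended arithmetic out of the telescoping
  argument.\<close>

lemma primal_dual_gap_sum:
  fixes K :: "'a::real_inner \<Rightarrow> 'b::real_inner"
    and x xp :: "nat \<Rightarrow> 'a" and y :: "nat \<Rightarrow> 'b" and G H \<epsilon> \<delta> :: "nat \<Rightarrow> real"
  assumes K: "bounded_linear K"
    and steps: "\<tau> > 0" "\<sigma> > 0" "\<tau> * \<sigma> * (onorm K)\<^sup>2 \<le> 1"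
    and xp: "xp 0 = x 0" "\<And>n. xp (Suc n) = x n"
    and x_step: "\<And>n. gu \<ge> G (Suc n) + 1 / \<tau> * ((x n - x (Suc n)) \<bullet> (u - x (Suc n)))
        - y (Suc n) \<bullet> K (u - x (Suc n)) - \<epsilon> (Suc n)"
    and y_step: "\<And>n. hv \<ge> H (Suc n) + 1 / \<sigma> * ((y n - y (Suc n)) \<bullet> (v - y (Suc n)))
        + K (2 *\<^sub>R x n - xp n) \<bullet> (v - y (Suc n)) - \<delta> (Suc n)"
  shows "(\<Sum>n=1..N. v \<bullet> K (x n) + G n - hv - (y n \<bullet> K u + gu - H n))
      \<le> 1 / (2 * \<tau>) * (norm (u - x 0))\<^sup>2 + 1 / (2 * \<sigma>) * (norm (v - y 0))\<^sup>2 + (\<Sum>n=1..N. \<epsilon> n + \<delta> n)"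
proof -
  interpret bounded_linear K by fact
  note coupling = coupling_bound[OF K steps]
  \<comment> \<open>The induction needs the boundary terms at \<open>N\<close>. At
    \<open>N = 0\<close> they cancel because \<open>xp 0 = x 0\<close>; at the end two of the
    negative squares absorb the remaining coupling term.\<close>
  have "(\<Sum>n=1..N. v \<bullet> K (x n) + G n - hv - (y n \<bullet> K u + gu - H n))
      \<le> 1 / (2 * \<tau>) * (norm (u - x 0))\<^sup>2 + 1 / (2 * \<sigma>) * (norm (v - y 0))\<^sup>2 + (\<Sum>n=1..N. \<epsilon> n + \<delta> n)
        - 1 / (2 * \<tau>) * (norm (u - x N))\<^sup>2 - 1 / (2 * \<sigma>) * (norm (v - y N))\<^sup>2
        - 1 / (2 * \<tau>) * (norm (x N - xp N))\<^sup>2 + (v - y N) \<bullet> K (x N - xp N)"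
  proof (induction N)
    case 0
    show ?case by (simp add: xp zero)
  next
    case (Suc N)
    \<comment> \<open>Splitting the extrapolated point as \<open>x N + (x N - xp N)\<close> makes
      the coupling a telescoping difference with one leftover product.\<close>
    have bilinear: "v \<bullet> K (x (Suc N)) - y (Suc N) \<bullet> K u + y (Suc N) \<bullet> K (u - x (Suc N))
          - K (2 *\<^sub>R x N - xp N) \<bullet> (v - y (Suc N))
        = (v - y (Suc N)) \<bullet> K (x (Suc N) - x N) - (v - y N) \<bullet> K (x N - xp N)
          - (y N - y (Suc N)) \<bullet> K (x N - xp N)"
      by (simp add: diff scale inner_simps inner_commute algebra_simps)
    have "v \<bullet> K (x (Suc N)) + G (Suc N) - hv - (y (Suc N) \<bullet> K u + gu - H (Suc N))
      \<le> 1 / (2 * \<tau>) * (norm (u - x N))\<^sup>2 + 1 / (2 * \<sigma>) * (norm (v - y N))\<^sup>2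
        - 1 / (2 * \<tau>) * (norm (u - x (Suc N)))\<^sup>2 - 1 / (2 * \<sigma>) * (norm (v - y (Suc N)))\<^sup>2
        - 1 / (2 * \<tau>) * (norm (x (Suc N) - x N))\<^sup>2 + 1 / (2 * \<tau>) * (norm (x N - xp N))\<^sup>2
        + (v - y (Suc N)) \<bullet> K (x (Suc N) - x N) - (v - y N) \<bullet> K (x N - xp N)
        + (\<epsilon> (Suc N) + \<delta> (Suc N))"
      \<comment> \<open>The leftover product is paid for by the squared dual increment of this step
        and the squared primal increment of the previous one.\<close>
      using x_step[of N] y_step[of N] bilinear coupling[of "y (Suc N) - y N" "x N - xp N"]
      unfolding three_point_identity by (simp add: inner_diff_left)
    with Suc.IH show ?case
      by (simp add: xp)
  qed
  moreover have "0 \<le> 1 / (2 * \<tau>) * (norm (u - x N))\<^sup>2"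
    using steps by simp
  ultimately show ?thesis
    using coupling[of "v - y N" "x N - xp N"] by linarith
qed

section \<open>Partial sums and convergence rates\<close>

text \<open>A discrete integral comparison: each term, times \<open>\<beta>\<close>, is at most the
  increment of \<open>real N powr \<beta>\<close>. This follows from weighted AM-GM for consecutive
  integers, multiplied by \<open>?b powr (\<beta> - 1)\<close>.\<close>

lemma sum_powr_le:
  assumes "0 < \<beta>" "\<beta> \<le> (1::real)"
  shows "(\<Sum>n=1..N. real n powr (\<beta> - 1)) \<le> real N powr \<beta> / \<beta>"
proof (induction N)
  case (Suc N)
  have "\<beta> * real (Suc N) powr (\<beta> - 1) \<le> real (Suc N) powr \<beta> - real N powr \<beta>"
  proof (cases "N = 0")
    case False
    let ?a = "real N" and ?b = "real (Suc N)"
    have "?a powr \<beta> * ?b powr (1 - \<beta>) \<le> \<beta> * ?a + (1 - \<beta>) * ?b"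
      using assms False by (intro Youngs_inequality_0) auto
    also have "\<dots> = ?b - \<beta>"
      by (simp add: algebra_simps)
    finally have "?a powr \<beta> * ?b powr (1 - \<beta>) * ?b powr (\<beta> - 1) \<le> (?b - \<beta>) * ?b powr (\<beta> - 1)"
      by (rule mult_right_mono) simp
    moreover have "?b powr (1 - \<beta>) * ?b powr (\<beta> - 1) = 1"
      by (simp flip: powr_add)
    moreover have "?b * ?b powr (\<beta> - 1) = ?b powr \<beta>"
      by (simp add: powr_mult_base)
    ultimately show ?thesis
      by (simp add: algebra_simps)
  qed (use assms in auto)
  with Suc.IH assms show ?case
    by (simp add: field_simps)
qed simp

lemma ergodic_rate:
  fixes D c \<alpha> :: real
  assumes "\<alpha> > 0" "D \<ge> 0" "c \<ge> 0"
  obtains C where "\<And>N. N \<ge> 2 \<Longrightarrow> 1 / real N * (D + c * (\<Sum>n=1..N. real n powr (- \<alpha>)))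
    \<le> (if \<alpha> > 1 then C * (1 / real N) else if \<alpha> = 1 then C * (ln (real N) / real N)
        else C * real N powr (- \<alpha>))"
proof -
  consider "\<alpha> > 1" | "\<alpha> = 1" | "\<alpha> < 1" by linarith
  then show thesis
  proof cases
    case 1
    have "summable (\<lambda>n. real n powr (- \<alpha>))"
      using 1 by (simp add: summable_real_powr_iff)
    then have le: "(\<Sum>n=1..N. real n powr (- \<alpha>)) \<le> (\<Sum>n. real n powr (- \<alpha>))" for N
      by (rule sum_le_suminf) auto
    show thesis
    proof (rule that[of "D + c * (\<Sum>n. real n powr (- \<alpha>))"])
      fix N :: nat assume "N \<ge> 2"
      have "1 / real N * (D + c * (\<Sum>n=1..N. real n powr (- \<alpha>)))
          \<le> 1 / real N * (D + c * (\<Sum>n. real n powr (- \<alpha>)))"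
        using le assms by (intro mult_left_mono add_left_mono) auto
      then show "1 / real N * (D + c * (\<Sum>n=1..N. real n powr (- \<alpha>)))
        \<le> (if \<alpha> > 1 then (D + c * (\<Sum>n. real n powr (- \<alpha>))) * (1 / real N)
            else if \<alpha> = 1 then (D + c * (\<Sum>n. real n powr (- \<alpha>))) * (ln (real N) / real N)
            else (D + c * (\<Sum>n. real n powr (- \<alpha>))) * real N powr (- \<alpha>))"
        using 1 by (simp add: mult.commute)
    qed
  next
    case 2
    \<comment> \<open>Since \<open>ln 2 \<le> ln N\<close>, the constant part \<open>D + c\<close>
      is absorbed at the price of dividing by \<open>ln 2\<close>; the other \<open>c\<close>
      multiplies the logarithm in the harmonic bound.\<close>
    show thesis
    proof (rule that[of "(D + c) / ln 2 + c"])
      fix N :: nat assume N: "N \<ge> 2"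
      have "(\<Sum>n=1..N. real n powr (- \<alpha>)) = harm N"
        unfolding harm_def by (intro sum.cong) (auto simp: 2 powr_minus)
      \<comment> \<open>The sequence \<open>harm n - ln n\<close> decreases and equals 1 at index
        1.\<close>
      also have "\<dots> \<le> 1 + ln (real N)"
        using euler_mascheroni_sequence_decreasing[of 1 N] N by (simp add: harm_def)
      finally have "D + c * (\<Sum>n=1..N. real n powr (- \<alpha>)) \<le> D + c * (1 + ln (real N))"
        using assms by (intro add_left_mono mult_left_mono)
      also have "\<dots> = (D + c) + c * ln (real N)"
        by (simp add: algebra_simps)
      also have "D + c \<le> (D + c) / ln 2 * ln (real N)"
      proof -
        have "(D + c) / ln 2 * ln 2 \<le> (D + c) / ln 2 * ln (real N)"
          using N assms by (intro mult_left_mono) auto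
        then show ?thesis by simp
      qed
      finally have "D + c * (\<Sum>n=1..N. real n powr (- \<alpha>)) \<le> ((D + c) / ln 2 + c) * ln (real N)"
        by (simp add: algebra_simps)
      then have "1 / real N * (D + c * (\<Sum>n=1..N. real n powr (- \<alpha>)))
          \<le> 1 / real N * (((D + c) / ln 2 + c) * ln (real N))"
        by (intro mult_left_mono) auto
      then show "1 / real N * (D + c * (\<Sum>n=1..N. real n powr (- \<alpha>)))
        \<le> (if \<alpha> > 1 then ((D + c) / ln 2 + c) * (1 / real N)
            else if \<alpha> = 1 then ((D + c) / ln 2 + c) * (ln (real N) / real N)
            else ((D + c) / ln 2 + c) * real N powr (- \<alpha>))"
        using 2 by simp
    qed
  next
    case 3
    \<comment> \<open>\<open>D\<close> is absorbed because \<open>real N powr (1 - \<alpha>)\<close>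
      is at least 1, and the sum bound with exponent \<open>1 - \<alpha>\<close> contributes
      \<open>c / (1 - \<alpha>)\<close>.\<close>
    show thesis
    proof (rule that[of "D + c / (1 - \<alpha>)"])
      fix N :: nat assume N: "N \<ge> 2"
      have ge1: "1 \<le> real N powr (1 - \<alpha>)"
        using N 3 by (intro ge_one_powr_ge_zero) auto
      have "(\<Sum>n=1..N. real n powr (- \<alpha>)) \<le> real N powr (1 - \<alpha>) / (1 - \<alpha>)"
        using sum_powr_le[of "1 - \<alpha>" N] 3 assms by simp
      then have "D * 1 + c * (\<Sum>n=1..N. real n powr (- \<alpha>))
          \<le> D * real N powr (1 - \<alpha>) + c * (real N powr (1 - \<alpha>) / (1 - \<alpha>))"
        using assms ge1 by (intro add_mono mult_left_mono)
      then have "1 / real N * (D + c * (\<Sum>n=1..N. real n powr (- \<alpha>)))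
          \<le> 1 / real N * ((D + c / (1 - \<alpha>)) * real N powr (1 - \<alpha>))"
        by (intro mult_left_mono) (auto simp: algebra_simps)
      also have "real N powr (1 - \<alpha>) = real N * real N powr (- \<alpha>)"
        using powr_mult_base[of "real N" "- \<alpha>"] by simp
      finally show "1 / real N * (D + c * (\<Sum>n=1..N. real n powr (- \<alpha>)))
        \<le> (if \<alpha> > 1 then (D + c / (1 - \<alpha>)) * (1 / real N)
            else if \<alpha> = 1 then (D + c / (1 - \<alpha>)) * (ln (real N) / real N)
            else (D + c / (1 - \<alpha>)) * real N powr (- \<alpha>))"
        using 3 N by simp
    qed
  qed
qed

text \<open>The finitely many indices before the asymptotic bound sets in are covered by adding
  their ratios to the constant. The start \<open>m\<close> makes room for comparison sequences such
  as \<open>real n powr (- \<alpha>)\<close>, which vanishes at 0.\<close>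

lemma bigo_sequence_bound:
  fixes f g :: "nat \<Rightarrow> real"
  assumes "f \<in> O(g)" "\<And>n. n \<ge> m \<Longrightarrow> g n > 0"
  obtains c where "c \<ge> 0" "\<And>n. n \<ge> m \<Longrightarrow> f n \<le> c * g n"
proof -
  obtain c where "c > 0" "eventually (\<lambda>n. norm (f n) \<le> c * norm (g n)) sequentially"
    using landau_o.bigE[OF assms(1)] by blast
  then obtain n0 where n0: "\<And>n. n \<ge> n0 \<Longrightarrow> \<bar>f n\<bar> \<le> c * \<bar>g n\<bar>"
    by (auto simp: eventually_sequentially)
  define c' where "c' = c + (\<Sum>n\<in>{m..<n0}. \<bar>f n\<bar> / g n)"
  have nonneg: "0 \<le> \<bar>f n\<bar> / g n" if "n \<ge> m" for n
    using assms(2)[OF that] by simp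
  show thesis
  proof (rule that[of c'])
    show "c' \<ge> 0"
      using \<open>c > 0\<close> nonneg by (auto simp: c'_def intro!: add_nonneg_nonneg sum_nonneg)
    fix n assume n: "n \<ge> m"
    have "\<bar>f n\<bar> / g n \<le> c'"
    proof (cases "n < n0")
      case True
      then have "\<bar>f n\<bar> / g n \<le> (\<Sum>n\<in>{m..<n0}. \<bar>f n\<bar> / g n)"
        using n nonneg by (intro member_le_sum) auto
      then show ?thesis using \<open>c > 0\<close> by (simp add: c'_def)
    next
      case False
      then have "\<bar>f n\<bar> / g n \<le> c"
        using n0[of n] assms(2)[OF n] by (simp add: field_simps)
      moreover have "0 \<le> (\<Sum>n\<in>{m..<n0}. \<bar>f n\<bar> / g n)"
        using nonneg by (intro sum_nonneg) auto
      ultimately show ?thesis by (simp add: c'_def)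
    qed
    then show "f n \<le> c' * g n"
      using assms(2)[OF n] by (simp add: field_simps)
  qed
qed

lemma inexact_prox2_ineq:
  assumes "inexact_prox2 e \<mu> f w z" "f z = ereal r" "f u = ereal s"
  shows "s \<ge> r + 1 / \<mu> * ((w - z) \<bullet> (u - z)) - e"
proof -
  have "f u \<ge> f z + ereal (((1 / \<mu>) *\<^sub>R (w - z)) \<bullet> (u - z)) - ereal e"
    using assms(1) unfolding inexact_prox2_def eps_subdifferential_def by blast
  then show ?thesis using assms(2,3) by simp
qed

section \<open>Assembly: from extended-real values to the gap bound and rates\<close>

theorem theorem3p7:
  fixes K :: "'a::{real_inner,complete_space} \<Rightarrow> 'b::{real_inner,complete_space}"
    and g :: "'a \<Rightarrow> ereal" and h :: "'b \<Rightarrow> ereal"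
    and \<tau> \<sigma> :: real
    and x :: "nat \<Rightarrow> 'a" and y :: "nat \<Rightarrow> 'b"
    and \<epsilon> \<delta> :: "nat \<Rightarrow> real"
  assumes K: "bounded_linear K"
    and g: "proper_fun g" "convex_fun g" "lsc_fun g"
    and h: "proper_fun h" "convex_fun h" "lsc_fun h"
    and saddle: "\<exists>xs ys. saddle_point (lagrangian K g h) xs ys"
    and steps: "\<tau> > 0" "\<sigma> > 0" "\<tau> * \<sigma> * (onorm K)\<^sup>2 < 1"
    and errors: "\<forall>n\<ge>1. \<epsilon> n \<ge> 0" "\<forall>n\<ge>1. \<delta> n \<ge> 0"
    and y_step: "\<forall>n. inexact_prox2 (\<delta> (n + 1)) \<sigma> (conjugate h)
        (y n + \<sigma> *\<^sub>R K (2 *\<^sub>R x n - (if n = 0 then x 0 else x (n - 1)))) (y (n + 1))"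
    and x_step: "\<forall>n. inexact_prox2 (\<epsilon> (n + 1)) \<tau> g
        (x n - \<tau> *\<^sub>R adjoint K (y (n + 1))) (x (n + 1))"
  shows "(\<forall>N\<ge>1. \<forall>u v.
      lagrangian K g h (ergodic_mean x N) v - lagrangian K g h u (ergodic_mean y N)
        \<le> ereal (1 / real N *
            (1 / (2 * \<tau>) * (norm (u - x 0))\<^sup>2 + 1 / (2 * \<sigma>) * (norm (v - y 0))\<^sup>2
              + (\<Sum>n=1..N. \<epsilon> n + \<delta> n))))
    \<and> (\<forall>\<alpha>>0. \<epsilon> \<in> O(\<lambda>n. real n powr (- \<alpha>)) \<and> \<delta> \<in> O(\<lambda>n. real n powr (- \<alpha>)) \<longrightarrow>
        (\<forall>u v. \<exists>C::real. \<forall>N\<ge>2.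
          lagrangian K g h (ergodic_mean x N) v - lagrangian K g h u (ergodic_mean y N)
            \<le> ereal (if \<alpha> > 1 then C * (1 / real N)
                else if \<alpha> = 1 then C * (ln (real N) / real N)
                else C * real N powr (- \<alpha>))))"
proof -
  interpret K: bounded_linear K by fact
  let ?h = "conjugate h"
  have hc: "proper_fun ?h"
    by (rule proper_conjugate[OF h])
  have "\<exists>r. g (x (Suc n)) = ereal r" for n
    using x_step g(1) eps_subdifferential_finite unfolding inexact_prox2_def
    by (metis Suc_eq_plus1)
  then obtain G where G: "\<And>n. g (x (Suc n)) = ereal (G (Suc n))"
    by (metis real_of_ereal.simps(1) that[of "\<lambda>n. real_of_ereal (g (x n))"])
  have "\<exists>r. ?h (y (Suc n)) = ereal r" for n
    using y_step hc eps_subdifferential_finite unfolding inexact_prox2_def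
    by (metis Suc_eq_plus1)
  then obtain H where H: "\<And>n. ?h (y (Suc n)) = ereal (H (Suc n))"
    by (metis real_of_ereal.simps(1) that[of "\<lambda>n. real_of_ereal (?h (y n))"])
  \<comment> \<open>The convention that the iterate before \<open>x 0\<close> is \<open>x 0\<close>
    itself.\<close>
  define xp where "xp n = (if n = 0 then x 0 else x (n - 1))" for n

  have bound: "lagrangian K g h (ergodic_mean x N) v - lagrangian K g h u (ergodic_mean y N)
      \<le> ereal (1 / real N *
          (1 / (2 * \<tau>) * (norm (u - x 0))\<^sup>2 + 1 / (2 * \<sigma>) * (norm (v - y 0))\<^sup>2
            + (\<Sum>n=1..N. \<epsilon> n + \<delta> n)))" (is "?gap \<le> ereal (1 / real N * ?R)")
    if N: "N \<ge> 1" for N u v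
  proof -
    let ?X = "ergodic_mean x N" and ?Y = "ergodic_mean y N"
    have "g ?X \<le> ereal (1 / real N * (\<Sum>n=1..N. G n))"
    proof (rule jensen_ergodic_mean[OF convex_epigraph_ereal[OF g(2)] N])
      show "g (x n) \<le> ereal (G n)" if "n \<ge> 1" for n
        using G[of "n - 1"] that by simp
    qed
    moreover have "g ?X \<noteq> -\<infinity>"
      using g(1) by (simp add: proper_fun_def)
    ultimately obtain a where a: "g ?X = ereal a" "a \<le> 1 / real N * (\<Sum>n=1..N. G n)"
      by (cases "g ?X") auto
    have "?h ?Y \<le> ereal (1 / real N * (\<Sum>n=1..N. H n))"
    proof (rule jensen_ergodic_mean[OF convex_epigraph_conjugate[OF h(1)] N])
      show "?h (y n) \<le> ereal (H n)" if "n \<ge> 1" for n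
        using H[of "n - 1"] that by simp
    qed
    moreover have "?h ?Y \<noteq> -\<infinity>"
      using hc by (simp add: proper_fun_def)
    ultimately obtain b where b: "?h ?Y = ereal b" "b \<le> 1 / real N * (\<Sum>n=1..N. H n)"
      by (cases "?h ?Y") auto
    show ?thesis
    proof (cases "g u = \<infinity> \<or> ?h v = \<infinity>")
      case True
      moreover have "g u \<noteq> -\<infinity>" "?h v \<noteq> -\<infinity>"
        using g(1) hc by (auto simp: proper_fun_def)
      \<comment> \<open>Both values at the ergodic means are finite, so an infinite
        \<open>g u\<close> or \<open>?h v\<close> can only push the difference down and no
        \<open>\<infinity> - \<infinity>\<close> occurs.\<close>
      ultimately have "?gap = -\<infinity>"
        using a(1) b(1) unfolding lagrangian_def by (cases "g u"; cases "?h v") auto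
      then show ?thesis by simp
    next
      case False
      moreover have "g u \<noteq> -\<infinity>" "?h v \<noteq> -\<infinity>"
        using g(1) hc by (auto simp: proper_fun_def)
      ultimately obtain gu hv where u: "g u = ereal gu" and v: "?h v = ereal hv"
        by (cases "g u"; cases "?h v") auto
      have sum_le: "(\<Sum>n=1..N. v \<bullet> K (x n) + G n - hv - (y n \<bullet> K u + gu - H n)) \<le> ?R"
      proof (rule primal_dual_gap_sum[where xp = xp, OF K steps(1,2)])
        show "\<tau> * \<sigma> * (onorm K)\<^sup>2 \<le> 1"
          using steps(3) by simp
        show "xp 0 = x 0" "xp (Suc n) = x n" for n
          by (simp_all add: xp_def)
        show "gu \<ge> G (Suc n) + 1 / \<tau> * ((x n - x (Suc n)) \<bullet> (u - x (Suc n)))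
            - y (Suc n) \<bullet> K (u - x (Suc n)) - \<epsilon> (Suc n)" for n
        proof -
          have "y (Suc n) \<bullet> K (u - x (Suc n)) = adjoint K (y (Suc n)) \<bullet> (u - x (Suc n))"
            using inner_adjoint[OF K] by (metis inner_commute)
          moreover have "gu \<ge> G (Suc n)
              + 1 / \<tau> * ((x n - \<tau> *\<^sub>R adjoint K (y (Suc n)) - x (Suc n)) \<bullet> (u - x (Suc n))) - \<epsilon> (Suc n)"
            using inexact_prox2_ineq[OF x_step[rule_format, of n], simplified, OF G u] by simp
          \<comment> \<open>The factor \<open>\<tau>\<close> in the proximal argument cancels,
            leaving the linear term that the adjoint moves back to \<open>K\<close>.\<close>
          moreover have "1 / \<tau> * ((x n - \<tau> *\<^sub>R adjoint K (y (Suc n)) - x (Suc n)) \<bullet> (u - x (Suc n)))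
              = 1 / \<tau> * ((x n - x (Suc n)) \<bullet> (u - x (Suc n))) - adjoint K (y (Suc n)) \<bullet> (u - x (Suc n))"
            using steps(1) by (simp add: inner_diff_left diff_divide_distrib)
          ultimately show ?thesis by linarith
        qed
        show "hv \<ge> H (Suc n) + 1 / \<sigma> * ((y n - y (Suc n)) \<bullet> (v - y (Suc n)))
            + K (2 *\<^sub>R x n - xp n) \<bullet> (v - y (Suc n)) - \<delta> (Suc n)" for n
        proof -
          let ?k = "K (2 *\<^sub>R x n - xp n)"
          have "inexact_prox2 (\<delta> (Suc n)) \<sigma> ?h (y n + \<sigma> *\<^sub>R ?k) (y (Suc n))"
            using y_step[rule_format, of n] by (simp only: xp_def Suc_eq_plus1)
          then have "hv \<ge> H (Suc n)
              + 1 / \<sigma> * ((y n + \<sigma> *\<^sub>R ?k - y (Suc n)) \<bullet> (v - y (Suc n))) - \<delta> (Suc n)"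
            by (rule inexact_prox2_ineq[OF _ H v])
          moreover have "1 / \<sigma> * ((y n + \<sigma> *\<^sub>R ?k - y (Suc n)) \<bullet> (v - y (Suc n)))
              = 1 / \<sigma> * ((y n - y (Suc n)) \<bullet> (v - y (Suc n))) + ?k \<bullet> (v - y (Suc n))"
            using steps(2) by (simp add: inner_diff_left inner_add_left diff_divide_distrib add_divide_distrib)
          ultimately show ?thesis by linarith
        qed
      qed
      have "v \<bullet> K ?X = 1 / real N * (\<Sum>n=1..N. v \<bullet> K (x n))"
        by (rule bounded_linear_ergodic_mean[OF N])
          (rule bounded_linear_compose[OF bounded_linear_inner_right K])
      moreover have "?Y \<bullet> K u = 1 / real N * (\<Sum>n=1..N. y n \<bullet> K u)"
        by (rule bounded_linear_ergodic_mean[OF N bounded_linear_inner_left])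
      moreover have "1 / real N * (\<Sum>n=1..N. v \<bullet> K (x n) + G n - hv - (y n \<bullet> K u + gu - H n))
          = 1 / real N * (\<Sum>n=1..N. v \<bullet> K (x n)) + 1 / real N * (\<Sum>n=1..N. G n) - hv
            - (1 / real N * (\<Sum>n=1..N. y n \<bullet> K u) + gu - 1 / real N * (\<Sum>n=1..N. H n))"
        using N by (simp add: sum.distrib sum_subtractf field_simps)
      ultimately have "v \<bullet> K ?X + a - hv - (?Y \<bullet> K u + gu - b) \<le> 1 / real N * ?R"
        using a(2) b(2) mult_left_mono[OF sum_le, of "1 / real N"] by simp
      then show ?thesis
        unfolding lagrangian_def a(1) b(1) u v by simp
    qed
  qed

  have rate: "\<exists>C::real. \<forall>N\<ge>2.
      lagrangian K g h (ergodic_mean x N) v - lagrangian K g h u (ergodic_mean y N)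
        \<le> ereal (if \<alpha> > 1 then C * (1 / real N)
            else if \<alpha> = 1 then C * (ln (real N) / real N)
            else C * real N powr (- \<alpha>))"
    if \<alpha>: "\<alpha> > 0" and O: "\<epsilon> \<in> O(\<lambda>n. real n powr (- \<alpha>))" "\<delta> \<in> O(\<lambda>n. real n powr (- \<alpha>))"
    for \<alpha> u v
  proof -
    define D where "D = 1 / (2 * \<tau>) * (norm (u - x 0))\<^sup>2 + 1 / (2 * \<sigma>) * (norm (v - y 0))\<^sup>2"
    have "D \<ge> 0"
      using steps by (simp add: D_def)
    obtain c where c: "c \<ge> 0" "\<And>n. n \<ge> 1 \<Longrightarrow> \<epsilon> n + \<delta> n \<le> c * real n powr (- \<alpha>)"
      \<comment> \<open>Starting at 1 avoids index 0, where the comparison sequence is zero.\<close>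
      using bigo_sequence_bound[OF sum_in_bigo(1)[OF O], of 1] by auto
    obtain C where C: "\<And>N. N \<ge> 2 \<Longrightarrow> 1 / real N * (D + c * (\<Sum>n=1..N. real n powr (- \<alpha>)))
        \<le> (if \<alpha> > 1 then C * (1 / real N) else if \<alpha> = 1 then C * (ln (real N) / real N)
            else C * real N powr (- \<alpha>))"
      using ergodic_rate[OF \<alpha> \<open>D \<ge> 0\<close> c(1)] by blast
    have "lagrangian K g h (ergodic_mean x N) v - lagrangian K g h u (ergodic_mean y N)
        \<le> ereal (if \<alpha> > 1 then C * (1 / real N) else if \<alpha> = 1 then C * (ln (real N) / real N)
            else C * real N powr (- \<alpha>))" if N: "N \<ge> 2" for N
    proof -
      have "lagrangian K g h (ergodic_mean x N) v - lagrangian K g h u (ergodic_mean y N)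
          \<le> ereal (1 / real N * (D + (\<Sum>n=1..N. \<epsilon> n + \<delta> n)))"
        using bound[of N v u] N by (simp only: D_def)
      also have "\<dots> \<le> ereal (1 / real N * (D + c * (\<Sum>n=1..N. real n powr (- \<alpha>))))"
        unfolding sum_distrib_left ereal_less_eq(3)
        using c(2) by (intro mult_left_mono add_left_mono sum_mono) auto
      also have "\<dots> \<le> ereal (if \<alpha> > 1 then C * (1 / real N)
          else if \<alpha> = 1 then C * (ln (real N) / real N) else C * real N powr (- \<alpha>))"
        using C[OF N] by (simp only: ereal_less_eq(3))
      finally show ?thesis .
    qed
    then show ?thesis by blast
  qed

  show ?thesis
    using bound rate by blast
qed

end
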